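(* Let $z_1,\dots,z_J$ be distinct points of the unit circle, $\phi(z)=\prod_{j=1}^J(1-\overline{z_j}z)$, and let $(a_n)_{n\ge0}$ be a sequence of complex numbers with $a_n\ne1$ for all $n$ and $\lim_{n\to\infty}n(1-a_n)=p$, where $p>1/2$ is real. Let $f_n(z)=z^n\phi(a_nz)$, let $H(K)$ be the reproducing kernel Hilbert space with kernel $K(z,\zeta)=\sum_{n=0}^\infty f_n(z)\overline{f_n(\zeta)}$, and let $\mathcal{D}$ be the natural domain of $H(K)$. Then $$\mathcal{D}=\mathbb{D}\cup\{z_1,z_2,\dots,z_J\},$$ where $\mathbb{D}$ is the open unit disc.
   Context: $J\ge1$ is an integer. The natural domain of $H(K)$ is $\mathrm{Dom}(K)=\{z\in\mathbb{C}:\sum_{n=0}^\infty|f_n(z)|^2<\infty\}$. *)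

theory Defs
  imports "HOL-Analysis.Analysis"
begin

definition phi :: "nat \<Rightarrow> (nat \<Rightarrow> complex) \<Rightarrow> complex \<Rightarrow> complex" where
  "phi J zs z = (\<Prod>j\<in>{1..J}. (1 - cnj (zs j) * z))"

definition basis_fun ::
  "nat \<Rightarrow> (nat \<Rightarrow> complex) \<Rightarrow> (nat \<Rightarrow> complex) \<Rightarrow> nat \<Rightarrow> complex \<Rightarrow> complex" where
  "basis_fun J zs a n z = z ^ n * phi J zs (a n * z)"

text \<open>
  The natural domain of the reproducing kernel Hilbert space H(K) with kernel
  K(z, w) = (SUM n. f n z * cnj (f n w)): the set of points of the complex plane at which the
  diagonal series K(z, z) converges. It depends on the functions f n, which are defined on
  all of the plane, only through this series.
\<close>
definition natural_domain :: "(nat \<Rightarrow> complex \<Rightarrow> complex) \<Rightarrow> complex set" where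
  "natural_domain f = {z. summable (\<lambda>n. (cmod (f n z))\<^sup>2)}"

end

theory Submission
  imports Defs
begin

text \<open>
  Convergence of \<open>n (1 - a n)\<close> gives \<open>a n \<longlonglongrightarrow> 1\<close>, so \<open>\<phi> (a n * z)\<close> tends to \<open>\<phi> z\<close> and the
  terms of the diagonal series behave like \<open>\<bar>z\<bar>\<^sup>2\<^sup>n \<bar>\<phi> z\<bar>\<^sup>2\<close> whenever \<open>\<phi> z \<noteq> 0\<close>. This settles every
  point but the zeros of \<open>\<phi>\<close>: inside the disc the series is dominated by a geometric one,
  and for \<open>\<bar>z\<bar> \<ge> 1\<close> with \<open>\<phi> z \<noteq> 0\<close> the terms
  do not tend to zero. Since the points \<open>z\<^sub>j\<close> have modulus one, they are exactly the zeros of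
  \<open>\<phi>\<close>. At such a zero the corresponding factor of \<open>\<phi> (a n * z\<^sub>j)\<close> is \<open>1 - a n\<close>, which is
  \<open>O(1 / n)\<close>, so that the series is dominated by a multiple of \<open>\<Sum> 1 / n\<^sup>2\<close>.
\<close>

lemma tendsto_phi:
  assumes "a \<longlonglongrightarrow> 1"
  shows "(\<lambda>n. phi J zs (a n * z)) \<longlonglongrightarrow> phi J zs z"
proof -
  have "(\<lambda>n. phi J zs (a n * z)) \<longlonglongrightarrow> phi J zs (1 * z)"
    unfolding phi_def by (intro tendsto_intros assms)
  then show ?thesis by simp
qed

lemma tendsto_1_if_scaled_diff_converges:
  fixes a :: "nat \<Rightarrow> 'a :: real_normed_field"
  assumes "(\<lambda>n. of_nat n * (1 - a n)) \<longlonglongrightarrow> c"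
  shows "a \<longlonglongrightarrow> 1"
proof -
  have "(\<lambda>n. 1 - inverse (of_nat n) * (of_nat n * (1 - a n))) \<longlonglongrightarrow> 1 - 0 * c"
    by (intro tendsto_intros assms lim_inverse_n)
  moreover have "\<forall>\<^sub>F n in sequentially. 1 - inverse (of_nat n) * (of_nat n * (1 - a n)) = a n"
    using eventually_gt_at_top[of 0] by eventually_elim (simp flip: mult.assoc)
  ultimately show ?thesis by (simp add: tendsto_cong)
qed

text \<open>Multiplying the \<open>j\<close>-th factor by \<open>z\<^sub>j\<close> turns it into \<open>z\<^sub>j - z\<close>, as \<open>z\<^sub>j\<close> has modulus one.\<close>

lemma phi_eq_0_iff:
  assumes "\<And>j. j \<in> {1..J} \<Longrightarrow> zs j \<in> sphere 0 1"
  shows "phi J zs z = 0 \<longleftrightarrow> z \<in> zs ` {1..J}"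
proof -
  have "1 - cnj (zs j) * z = 0 \<longleftrightarrow> z = zs j" if "j \<in> {1..J}" for j
  proof -
    have "zs j * cnj (zs j) = 1"
      using complex_norm_square[of "zs j"] assms[OF that] by simp
    then have "zs j * (1 - cnj (zs j) * z) = zs j - z" "zs j \<noteq> 0"
      by (auto simp: algebra_simps)
    then show ?thesis by (metis mult_eq_0_iff right_minus_eq)
  qed
  then show ?thesis by (auto simp: phi_def)
qed

lemma ball_subset_natural_domain:
  assumes "a \<longlonglongrightarrow> 1"
  shows "ball 0 1 \<subseteq> natural_domain (basis_fun J zs a)"
proof
  fix z :: complex assume "z \<in> ball 0 1"
  then have z: "cmod z < 1" by simp
  obtain B where B: "\<And>n. cmod (phi J zs (a n * z)) \<le> B"
    using convergent_imp_Bseq[OF convergentI[OF tendsto_phi[OF assms]]] by (meson BseqE)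
  have "(cmod z)\<^sup>2 < 1" using z by (simp add: power_less_one_iff abs_square_less_1)
  then have "summable (\<lambda>n. B\<^sup>2 * ((cmod z)\<^sup>2) ^ n)"
    by (intro summable_mult summable_geometric) simp
  moreover have "norm ((cmod (basis_fun J zs a n z))\<^sup>2) \<le> B\<^sup>2 * ((cmod z)\<^sup>2) ^ n" for n
  proof -
    have "(cmod (basis_fun J zs a n z))\<^sup>2 = ((cmod z)\<^sup>2) ^ n * (cmod (phi J zs (a n * z)))\<^sup>2"
      by (simp only: basis_fun_def norm_mult norm_power power2_eq_square
          power_mult_distrib mult_ac)
    also have "\<dots> \<le> ((cmod z)\<^sup>2) ^ n * B\<^sup>2"
      by (intro mult_left_mono power_mono B) auto
    finally show ?thesis by (simp add: mult.commute)
  qed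
  ultimately show "z \<in> natural_domain (basis_fun J zs a)"
    unfolding natural_domain_def mem_Collect_eq by (rule summable_comparison_test'[where N = 0])
qed

text \<open>
  Here the rate at which \<open>a n\<close> tends to 1 matters, not just the limit: since \<open>n (1 - a n)\<close>
  converges and the other factors of \<open>\<phi>\<close> converge as well, \<open>n * \<phi> (a n * z\<^sub>k)\<close> is bounded.
\<close>

lemma zero_in_natural_domain:
  assumes "k \<in> {1..J}" and "zs k \<in> sphere 0 1"
    and lim: "(\<lambda>n. of_nat n * (1 - a n)) \<longlonglongrightarrow> c"
  shows "zs k \<in> natural_domain (basis_fun J zs a)"
proof -
  have unit: "cmod (zs k) = 1" using assms(2) by simp
  then have inv: "cnj (zs k) * (a n * zs k) = a n" for n
    using complex_norm_square[of "zs k"] by (simp add: mult_ac)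
  have split_factor: "phi J zs (a n * zs k)
      = (1 - a n) * (\<Prod>j\<in>{1..J}-{k}. 1 - cnj (zs j) * (a n * zs k))" for n
    unfolding phi_def using assms(1) by (subst prod.remove[of _ k]) (auto simp: inv)
  have "(\<lambda>n. (of_nat n * (1 - a n)) * (\<Prod>j\<in>{1..J}-{k}. 1 - cnj (zs j) * (a n * zs k)))
      \<longlonglongrightarrow> c * (\<Prod>j\<in>{1..J}-{k}. 1 - cnj (zs j) * (1 * zs k))"
    by (intro tendsto_intros lim tendsto_1_if_scaled_diff_converges[OF lim])
  then have "Bseq (\<lambda>n. of_nat n * phi J zs (a n * zs k))"
    unfolding split_factor mult.assoc by (intro convergent_imp_Bseq convergentI)
  then obtain B where B: "\<And>n. cmod (of_nat n * phi J zs (a n * zs k)) \<le> B"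
    unfolding Bseq_def by blast
  have "summable (\<lambda>n. B\<^sup>2 * inverse (real n ^ 2))"
    by (intro summable_mult inverse_power_summable) auto
  moreover have "norm ((cmod (basis_fun J zs a n (zs k)))\<^sup>2) \<le> B\<^sup>2 * inverse (real n ^ 2)"
    if "n \<ge> 1" for n
  proof -
    have "(real n)\<^sup>2 * (cmod (phi J zs (a n * zs k)))\<^sup>2 \<le> B\<^sup>2"
      using power_mono[OF B[of n], of 2] by (simp add: norm_mult power_mult_distrib)
    then show ?thesis
      using that unit by (simp add: basis_fun_def norm_mult norm_power field_simps)
  qed
  ultimately show ?thesis
    unfolding natural_domain_def mem_Collect_eq by (rule summable_comparison_test')
qed

lemma outside_natural_domain:
  assumes "a \<longlonglongrightarrow> 1" and "cmod z \<ge> 1" and "phi J zs z \<noteq> 0"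
  shows "z \<notin> natural_domain (basis_fun J zs a)"
proof
  assume "z \<in> natural_domain (basis_fun J zs a)"
  then have "(\<lambda>n. (cmod (basis_fun J zs a n z))\<^sup>2) \<longlonglongrightarrow> 0"
    by (auto simp: natural_domain_def dest: summable_LIMSEQ_zero)
  moreover have "(\<lambda>n. (cmod (phi J zs (a n * z)))\<^sup>2) \<longlonglongrightarrow> (cmod (phi J zs z))\<^sup>2"
    by (intro tendsto_intros tendsto_phi assms)
  moreover have "(cmod (phi J zs (a n * z)))\<^sup>2 \<le> (cmod (basis_fun J zs a n z))\<^sup>2" for n
  proof (intro power_mono)
    have "1 * cmod (phi J zs (a n * z)) \<le> cmod z ^ n * cmod (phi J zs (a n * z))"
      by (intro mult_right_mono one_le_power assms) auto
    then show "cmod (phi J zs (a n * z)) \<le> cmod (basis_fun J zs a n z)"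
      by (simp add: basis_fun_def norm_mult norm_power)
  qed simp
  ultimately have "(cmod (phi J zs z))\<^sup>2 \<le> 0" by (blast intro: LIMSEQ_le)
  with assms(3) show False by simp
qed

theorem proposition9:
  fixes J :: nat and zs :: "nat \<Rightarrow> complex" and a :: "nat \<Rightarrow> complex" and p :: real
  assumes "J \<ge> 1"
    and "\<And>j. j \<in> {1..J} \<Longrightarrow> zs j \<in> sphere 0 1"
    and "inj_on zs {1..J}"
    and "\<And>n. a n \<noteq> 1"
    and "(\<lambda>n. of_nat n * (1 - a n)) \<longlonglongrightarrow> of_real p"
    and "p > 1 / 2"
  shows "natural_domain (basis_fun J zs a) = ball 0 1 \<union> zs ` {1..J}"
proof
  have lim: "a \<longlonglongrightarrow> 1"
    using assms(5) by (rule tendsto_1_if_scaled_diff_converges)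
  show "natural_domain (basis_fun J zs a) \<subseteq> ball 0 1 \<union> zs ` {1..J}"
  proof
    fix z assume "z \<in> natural_domain (basis_fun J zs a)"
    then have "cmod z < 1 \<or> phi J zs z = 0"
      using outside_natural_domain[OF lim] by force
    then show "z \<in> ball 0 1 \<union> zs ` {1..J}"
      using phi_eq_0_iff[OF assms(2)] by auto
  qed
  show "ball 0 1 \<union> zs ` {1..J} \<subseteq> natural_domain (basis_fun J zs a)"
  proof -
    have "zs k \<in> natural_domain (basis_fun J zs a)" if "k \<in> {1..J}" for k
      using that assms(2)[OF that] assms(5) by (rule zero_in_natural_domain)
    then show ?thesis using ball_subset_natural_domain[OF lim] by blast
  qed
qed

end
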